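(* Let $f\in\mathcal{S}$. Then $f\in\mathcal{SL}^*$ if and only if $$\frac1z\,(f*H_t)(z)\neq 0\qquad\text{for all } z\in\Delta,$$ for every $t\in(0,2)$ and each of the two choices of sign in $S(t)$, where $$H_t(z)=\frac{z}{(1-z)(1-S(t))}\left(\frac{1}{1-z}-S(t)\right),\qquad S(t)=\sqrt{t}+i\left(\pm\sqrt{\sqrt{1+4t}-(t+1)}\right),\quad 0<t<2.$$
   Context: $\Delta=\{z\in\mathbb{C}:|z|<1\}$ is the open unit disk. $\mathcal{A}$ is the class of analytic functions on $\Delta$ of the form $f(z)=z+\sum_{n=2}^{\infty}a_nz^n$, and $\mathcal{S}\subset\mathcal{A}$ is the subclass of univalent (injective) functions. For analytic functions $F,G$ on $\Delta$, $F$ is subordinate to $G$, written $F\prec G$, if there is an analytic function $\omega:\Delta\to\mathbb{C}$ with $\omega(0)=0$ and $|\omega(z)|<1$ for $z\in\Delta$ such that $F(z)=G(\omega(z))$ for all $z\in\Delta$. The class $\mathcal{SL}^*$ is $$\mathcal{SL}^*=\left\{f\in\mathcal{A}:\ \frac{zf'(z)}{f(z)}\prec\sqrt{1+z},\ z\in\Delta\right\},$$ where $\sqrt{\cdot}$ is the principal branch (value $1$ at $z=0$), and $zf'(z)/f(z)$ is understood to take the value $1$ at $z=0$. For $f(z)=z+\sum_{n\ge2}a_nz^n$ and $g(z)=z+\sum_{n\ge2}b_nz^n$ analytic in $\Delta$, the Hadamard product (convolution) is $(f*g)(z)=z+\sum_{n\ge2}a_nb_nz^n$. The quotient $\frac1z(f*H_t)(z)$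 is understood at $z=0$ by its removable-singularity value. *)

theory Defs
  imports "HOL-Complex_Analysis.Complex_Analysis"
begin

abbreviation unit_disk :: "complex set" where
  "unit_disk \<equiv> ball 0 1"

text \<open>
  Functions on the unit disk are total functions on the complex plane; their values outside
  the disk play no role.
\<close>

definition class_A :: "(complex \<Rightarrow> complex) set" where
  "class_A = {f. f holomorphic_on unit_disk \<and>
     (\<exists>a :: nat \<Rightarrow> complex. \<forall>z\<in>unit_disk. (\<lambda>n. a (n + 2) * z ^ (n + 2)) sums (f z - z))}"

definition class_S :: "(complex \<Rightarrow> complex) set" where
  "class_S = {f \<in> class_A. inj_on f unit_disk}"

definition subordinate :: "(complex \<Rightarrow> complex) \<Rightarrow> (complex \<Rightarrow> complex) \<Rightarrow> bool" where
  "subordinate F G \<longleftrightarrow>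
     F holomorphic_on unit_disk \<and> G holomorphic_on unit_disk \<and>
     (\<exists>\<omega>. \<omega> holomorphic_on unit_disk \<and> \<omega> 0 = 0 \<and>
          (\<forall>z\<in>unit_disk. norm (\<omega> z) < 1) \<and>
          (\<forall>z\<in>unit_disk. F z = G (\<omega> z)))"

text \<open>
  The convention \<open>x / 0 = 0\<close> admits no spurious members: where \<open>f z = 0\<close> with \<open>z \<noteq> 0\<close> the
  quotient below is \<open>0\<close>, a value that \<open>csqrt (1 + w)\<close> does not take on the disk.
\<close>

definition class_SL :: "(complex \<Rightarrow> complex) set" where
  "class_SL = {f \<in> class_A.
     subordinate (\<lambda>z. if z = 0 then 1 else z * deriv f z / f z) (\<lambda>z. csqrt (1 + z))}"

definition taylor_coeff :: "(complex \<Rightarrow> complex) \<Rightarrow> nat \<Rightarrow> complex" where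
  "taylor_coeff f n = fps_nth (fps_expansion f 0) n"

text \<open>
  As for the normalised functions it is applied to, the coefficient of \<open>z\<close> is fixed to be
  \<open>1\<close> and the constant term to be \<open>0\<close>.
\<close>

definition hadamard :: "(complex \<Rightarrow> complex) \<Rightarrow> (complex \<Rightarrow> complex) \<Rightarrow> complex \<Rightarrow> complex" where
  "hadamard f g z = z + (\<Sum>n. taylor_coeff f (n + 2) * taylor_coeff g (n + 2) * z ^ (n + 2))"

text \<open>The parameter \<open>\<sigma>\<close>, to be taken from \<open>{1, -1}\<close>, is the choice of sign.\<close>

definition S_fun :: "real \<Rightarrow> real \<Rightarrow> complex" where
  "S_fun \<sigma> t = complex_of_real (sqrt t) +
     \<i> * complex_of_real (\<sigma> * sqrt (sqrt (1 + 4 * t) - (t + 1)))"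

definition H_fun :: "real \<Rightarrow> real \<Rightarrow> complex \<Rightarrow> complex" where
  "H_fun \<sigma> t z = z / ((1 - z) * (1 - S_fun \<sigma> t)) * (1 / (1 - z) - S_fun \<sigma> t)"

end

theory Submission imports Defs
begin

text \<open>
  The points \<open>S(t)\<close>, together with \<open>0\<close> and \<open>\<surd>2\<close>, make up the boundary of the
  right half of the Bernoulli lemniscate \<open>|w\<^sup>2 - 1| < 1\<close>, which is the image of the disk under
  \<open>\<surd>(1 + z)\<close>. Since \<open>f * H\<^sub>t = (z f' - S f) / (1 - S)\<close>, the convolution condition
  says that \<open>p = z f' / f\<close> omits every \<open>S(t)\<close>. By univalence \<open>p\<close> omits \<open>0\<close>, and by the open
  mapping theorem it omits \<open>\<surd>2\<close> as well, so the connected set \<open>p(\<Delta>)\<close>, which contains \<open>1\<close>,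
  stays inside the half lemniscate.
\<close>

section \<open>Geometry of the half lemniscate and its boundary\<close>

definition half_lemniscate :: "complex set" where
  "half_lemniscate = {w. Re w > 0 \<and> norm (w\<^sup>2 - 1) < 1}"

text \<open>With \<open>w = x + i y\<close>, expanding gives
  \<open>|w^2 - 1|^2 = (x^2 + y^2)^2 - 2 (x^2 - y^2) + 1\<close>; the right-hand side is the
  Cartesian equation of the lemniscate.\<close>

lemma norm_square_minus_1_eq_1_iff:
  "norm (w\<^sup>2 - 1) = 1 \<longleftrightarrow> ((Re w)\<^sup>2 + (Im w)\<^sup>2)\<^sup>2 = 2 * ((Re w)\<^sup>2 - (Im w)\<^sup>2)"
proof -
  have "norm (w\<^sup>2 - 1) = 1 \<longleftrightarrow> (norm (w\<^sup>2 - 1))\<^sup>2 = 1"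
    by (simp add: power2_eq_1_iff) (smt (verit) norm_ge_zero)
  also have "(norm (w\<^sup>2 - 1))\<^sup>2 = ((Re w)\<^sup>2 - (Im w)\<^sup>2 - 1)\<^sup>2 + (2 * Re w * Im w)\<^sup>2"
    unfolding cmod_power2 by (simp add: power2_eq_square)
  also have "\<dots> = 1 \<longleftrightarrow> ((Re w)\<^sup>2 + (Im w)\<^sup>2)\<^sup>2 = 2 * ((Re w)\<^sup>2 - (Im w)\<^sup>2)"
    by (simp add: power2_eq_square algebra_simps)
  finally show ?thesis .
qed

text \<open>Makes the radicand in \<open>S_fun\<close> nonnegative, so that squaring the imaginary
  part undoes the root.\<close>

lemma sqrt_1_plus_4t_ge:
  fixes t :: real
  assumes "0 < t" "t < 2"
  shows "t + 1 \<le> sqrt (1 + 4 * t)"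
proof (rule real_le_rsqrt)
  have "t * t \<le> 2 * t"
    using assms by (intro mult_right_mono) auto
  then show "(t + 1)\<^sup>2 \<le> 1 + 4 * t"
    by (simp add: power2_eq_square algebra_simps)
qed

text \<open>With \<open>q = sqrt (1 + 4 * t)\<close> the squared coordinates are \<open>t\<close>
  and \<open>q - (t + 1)\<close>, and the lemniscate equation
  \<open>(q - 1)^2 = 2 (2 t + 1 - q)\<close> reduces to \<open>q^2 = 1 + 4 t\<close>. Only squares
  enter, so the sign does not matter.\<close>

lemma norm_S_fun_square_minus_1:
  assumes "0 < t" "t < 2" "\<sigma> \<in> {1, -1}"
  shows "norm ((S_fun \<sigma> t)\<^sup>2 - 1) = 1"
proof -
  define q where "q = sqrt (1 + 4 * t)"
  have q: "q\<^sup>2 = 1 + 4 * t" "q - (t + 1) \<ge> 0"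
    using assms sqrt_1_plus_4t_ge[of t] by (simp_all add: q_def)
  have re: "(Re (S_fun \<sigma> t))\<^sup>2 = t"
    using assms by (simp add: S_fun_def)
  have "(\<sigma> * sqrt (q - (t + 1)))\<^sup>2 = q - (t + 1)"
    using assms q by (auto simp: power_mult_distrib)
  then have im: "(Im (S_fun \<sigma> t))\<^sup>2 = q - (t + 1)"
    by (simp add: S_fun_def q_def)
  show ?thesis
    unfolding norm_square_minus_1_eq_1_iff re im
    using q by (simp add: power2_eq_square algebra_simps)
qed

lemma S_fun_neq_1:
  assumes "0 < t" "t < 2" "\<sigma> \<in> {1, -1}"
  shows "S_fun \<sigma> t \<noteq> 1"
  using norm_S_fun_square_minus_1[OF assms] by auto

text \<open>The parameters are read off from \<open>w\<close>: \<open>t\<close> is the square of its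
  real part and \<open>\<sigma>\<close> the sign of its imaginary part.\<close>

lemma lemniscate_point_eq_S_fun:
  assumes "Re w > 0" "norm (w\<^sup>2 - 1) = 1" "Im w \<noteq> 0"
  obtains t \<sigma> where "0 < t" "t < 2" "\<sigma> \<in> {1, -1}" "w = S_fun \<sigma> t"
proof
  define x y where "x = Re w" and "y = Im w"
  define \<sigma> :: real where "\<sigma> = sgn y"
  have eq: "(x\<^sup>2 + y\<^sup>2)\<^sup>2 = 2 * (x\<^sup>2 - y\<^sup>2)"
    using assms by (simp add: norm_square_minus_1_eq_1_iff x_def y_def)
  have x: "x > 0" and y: "y \<noteq> 0"
    using assms by (auto simp: x_def y_def)
  show "0 < x\<^sup>2"
    using x by simp
  \<comment> \<open>Here \<open>y \<noteq> 0\<close> yields the strict bound on \<open>t\<close>,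
    which keeps \<open>w\<close> away from the vertex \<open>sqrt 2\<close>.\<close>
  have "x\<^sup>2 * x\<^sup>2 \<le> (x\<^sup>2 + y\<^sup>2)\<^sup>2"
    by (simp add: power2_eq_square mult_mono)
  also have "\<dots> < 2 * x\<^sup>2"
    using y by (simp add: eq)
  finally show "x\<^sup>2 < 2"
    by (rule mult_right_less_imp_less) simp
  show "\<sigma> \<in> {1, -1}"
    using y by (auto simp: \<sigma>_def sgn_if)
  \<comment> \<open>Adding \<open>2 (x^2 + y^2) + 1\<close> to both sides of \<open>eq\<close>
    completes the square. The radicand in \<open>S_fun\<close> is thus \<open>y^2\<close>.\<close>
  have "sqrt (1 + 4 * x\<^sup>2) = x\<^sup>2 + y\<^sup>2 + 1"
    using eq by (intro real_sqrt_unique) (auto simp: power2_eq_square algebra_simps)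
  then have "S_fun \<sigma> (x\<^sup>2) = complex_of_real x + \<i> * complex_of_real (\<sigma> * \<bar>y\<bar>)"
    using x by (simp add: S_fun_def)
  also have "\<dots> = w"
    by (simp add: \<sigma>_def x_def y_def complex_eq_iff sgn_mult_abs)
  finally show "w = S_fun \<sigma> (x\<^sup>2)" ..
qed

text \<open>The vertex \<open>sqrt 2\<close> is the excluded endpoint \<open>t = 2\<close>, where
  the radicand \<open>sqrt 9 - 3\<close> vanishes; it is a limit of points of the curve.\<close>

lemma S_fun_tendsto_sqrt_2: "(S_fun 1 \<longlongrightarrow> complex_of_real (sqrt 2)) (at_left 2)"
proof -
  have "sqrt 9 = (3 :: real)"
    by (rule real_sqrt_unique) auto
  then have "S_fun 1 2 = complex_of_real (sqrt 2)"
    by (simp add: S_fun_def)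
  moreover have "(S_fun 1 \<longlongrightarrow> S_fun 1 2) (at_left 2)"
    unfolding S_fun_def by (intro tendsto_intros)
  ultimately show ?thesis
    by simp
qed

lemma open_half_lemniscate: "open half_lemniscate"
  unfolding half_lemniscate_def
  by (intro open_Collect_conj open_Collect_less continuous_intros)

lemma frontier_half_lemniscate_cases:
  assumes "w \<in> frontier half_lemniscate"
  obtains "w = 0" | "w = complex_of_real (sqrt 2)"
  | t \<sigma> where "0 < t" "t < 2" "\<sigma> \<in> {1, -1}" "w = S_fun \<sigma> t"
proof -
  have "closed {w. Re w \<ge> 0 \<and> norm (w\<^sup>2 - 1) \<le> (1 :: real)}"
    by (intro closed_Collect_conj closed_Collect_le continuous_intros)
  then have "closure half_lemniscate \<subseteq> {w. Re w \<ge> 0 \<and> norm (w\<^sup>2 - 1) \<le> 1}"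
    by (intro closure_minimal) (auto simp: half_lemniscate_def)
  moreover have "w \<in> closure half_lemniscate" "w \<notin> half_lemniscate"
    using assms open_half_lemniscate by (auto simp: frontier_def interior_open)
  ultimately have re: "Re w \<ge> 0" and le: "norm (w\<^sup>2 - 1) \<le> 1"
    and ge: "Re w = 0 \<or> norm (w\<^sup>2 - 1) \<ge> 1"
    by (auto simp: half_lemniscate_def)
  show thesis
  proof (cases "Re w = 0")
    case True
    \<comment> \<open>On the imaginary axis \<open>w^2 - 1 = -(Im w)^2 - 1\<close>, so the closed
      lemniscate meets this axis only at its node \<open>0\<close>.\<close>
    have "\<bar>Re (w\<^sup>2 - 1)\<bar> \<le> 1"
      using abs_Re_le_cmod le by (rule order_trans)
    then have "(Im w)\<^sup>2 \<le> 0"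
      using True by (simp add: power2_eq_square abs_if split: if_splits)
    then have "w = 0"
      using True by (simp add: complex_eq_iff)
    then show ?thesis
      by (rule that(1))
  next
    case False
    then have pos: "Re w > 0" and one: "norm (w\<^sup>2 - 1) = 1"
      using re le ge by auto
    show ?thesis
    proof (cases "Im w = 0")
      case True
      then have "(Re w)\<^sup>2 * (Re w)\<^sup>2 = 2 * (Re w)\<^sup>2"
        using one unfolding norm_square_minus_1_eq_1_iff by (simp add: power2_eq_square)
      then have "(Re w)\<^sup>2 = 2"
        using pos by (simp only: mult_cancel_right) simp
      then have "sqrt 2 = Re w"
        using pos by (intro real_sqrt_unique) auto
      then have "w = complex_of_real (sqrt 2)"
        using True by (simp add: complex_eq_iff)
      then show ?thesis
        by (rule that(2))
    next
      case False
      then show ?thesis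
        using lemniscate_point_eq_S_fun[OF pos one] that(3) by metis
    qed
  qed
qed

section \<open>Images of the disk in the half lemniscate, and subordination\<close>

lemma holomorphic_image_subset_half_lemniscate:
  assumes hol: "p holomorphic_on unit_disk" and p0: "p 0 = 1"
    and nz: "\<And>z. z \<in> unit_disk \<Longrightarrow> p z \<noteq> 0"
    and nS: "\<And>t \<sigma> z. \<lbrakk>0 < t; t < 2; \<sigma> \<in> {1, -1}; z \<in> unit_disk\<rbrakk> \<Longrightarrow> p z \<noteq> S_fun \<sigma> t"
  shows "p ` unit_disk \<subseteq> half_lemniscate"
proof (rule ccontr)
  assume "\<not> ?thesis"
  moreover have "1 \<in> p ` unit_disk \<inter> half_lemniscate"
    using p0 by (force simp: half_lemniscate_def intro: rev_image_eqI[of 0])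
  moreover have "connected (p ` unit_disk)"
    by (intro connected_continuous_image holomorphic_on_imp_continuous_on hol) auto
  ultimately obtain z where z: "z \<in> unit_disk" and "p z \<in> frontier half_lemniscate"
    using connected_Int_frontier[of "p ` unit_disk" half_lemniscate] by blast
  from this(2) show False
  proof (cases rule: frontier_half_lemniscate_cases)
    case 1
    then show ?thesis using nz[OF z] by simp
  next
    case (3 t \<sigma>)
    then show ?thesis using nS[OF _ _ _ z] by blast
  next
    case 2
    have "\<not> p constant_on unit_disk"
    proof
      assume "p constant_on unit_disk"
      then have "p z = p 0"
        using z unfolding constant_on_def by (metis centre_in_ball zero_less_one)
      then have "complex_of_real (sqrt 2) = complex_of_real 1"
        using 2 p0 by simp
      then show False
        unfolding of_real_eq_iff by simp
    qed
    then have "open (p ` unit_disk)"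
      by (intro open_mapping_thm[OF hol]) auto
    \<comment> \<open>An open image containing \<open>sqrt 2\<close> would also contain
      \<open>S_fun 1 t\<close> for all \<open>t\<close> slightly below 2, against
      \<open>nS\<close>.\<close>
    then have "\<forall>\<^sub>F t in at_left 2. S_fun 1 t \<in> p ` unit_disk"
      using z 2 by (intro topological_tendstoD[OF S_fun_tendsto_sqrt_2]) (auto intro: rev_image_eqI)
    moreover have "\<forall>\<^sub>F t in at_left 2. t \<in> {0<..<2::real}"
      by (rule eventually_at_left_real) simp
    ultimately have "\<forall>\<^sub>F t in at_left (2::real). False"
    proof eventually_elim
      case (elim t)
      then show ?case using nS[of t 1] by force
    qed
    then show ?thesis
      by simp
  qed
qed

lemma csqrt_1_plus_in_half_lemniscate:
  assumes "norm w < 1"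
  shows "csqrt (1 + w) \<in> half_lemniscate"
proof -
  have "\<bar>Re w\<bar> < 1"
    using abs_Re_le_cmod assms by (rule le_less_trans)
  then have "cmod (1 + w) + Re (1 + w) > 0"
    by (intro add_nonneg_pos) auto
  then have "Re (csqrt (1 + w)) > 0"
    by simp
  then show ?thesis
    using assms by (simp add: half_lemniscate_def del: csqrt.simps)
qed

text \<open>The Schwarz function is forced to be \<open>p^2 - 1\<close>. Positivity of
  \<open>Re (p z)\<close> ensures that the principal root of \<open>(p z)^2\<close> is
  \<open>p z\<close> and not its negative.\<close>

lemma subordinate_csqrt_iff:
  assumes "p holomorphic_on unit_disk" "p 0 = 1"
  shows "subordinate p (\<lambda>z. csqrt (1 + z)) \<longleftrightarrow> p ` unit_disk \<subseteq> half_lemniscate"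
proof
  assume "subordinate p (\<lambda>z. csqrt (1 + z))"
  then show "p ` unit_disk \<subseteq> half_lemniscate"
    by (auto simp: subordinate_def csqrt_1_plus_in_half_lemniscate)
next
  assume sub: "p ` unit_disk \<subseteq> half_lemniscate"
  have "1 + z \<notin> \<real>\<^sub>\<le>\<^sub>0" if "norm z < 1" for z :: complex
    using abs_Re_le_cmod[of z] that by (auto simp: complex_nonpos_Reals_iff)
  then have hol: "(\<lambda>z. csqrt (1 + z)) holomorphic_on unit_disk"
    by (intro holomorphic_intros) auto
  have "p z = csqrt (1 + ((p z)\<^sup>2 - 1))" if "z \<in> unit_disk" for z
  proof -
    have "p z \<in> half_lemniscate"
      using sub that by blast
    then show ?thesis
      by (simp add: half_lemniscate_def csqrt_square)
  qed
  moreover have "(\<lambda>z. (p z)\<^sup>2 - 1) holomorphic_on unit_disk"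
    using assms by (intro holomorphic_intros)
  ultimately show "subordinate p (\<lambda>z. csqrt (1 + z))"
    unfolding subordinate_def using assms hol sub
    by (intro conjI exI[of _ "\<lambda>z. (p z)\<^sup>2 - 1"]) (auto simp: half_lemniscate_def)
qed

section \<open>Taylor coefficients and the convolution with \<open>H_fun\<close>\<close>

lemma class_A_at_0:
  assumes "f \<in> class_A"
  shows "f 0 = 0" "deriv f 0 = 1"
proof -
  obtain a where a: "\<And>z. z \<in> unit_disk \<Longrightarrow> (\<lambda>n. a (n + 2) * z ^ (n + 2)) sums (f z - z)"
    using assms unfolding class_A_def by blast
  define F where "F = Abs_fps (\<lambda>n. if n = 0 then 0 else if n = 1 then 1 else a n)"
  have "(\<lambda>n. fps_nth F n * z ^ n) sums f z" if "z \<in> unit_disk" for z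
    by (rule sums_iff_shift'[of _ 2, THEN iffD1])
       (use a[OF that] in \<open>simp add: F_def eval_nat_numeral\<close>)
  then have "\<forall>\<^sub>F z in nhds 0. (\<lambda>n. fps_nth F n * z ^ n) sums f z"
    by (intro eventually_nhds_in_open[THEN eventually_mono, of unit_disk]) auto
  then have F: "f has_fps_expansion F"
    by (rule has_fps_expansionI)
  show "f 0 = 0" "deriv f 0 = 1"
    using fps_nth_fps_expansion[OF F, of 0] fps_nth_fps_expansion[OF F, of 1]
    by (simp_all add: F_def)
qed

text \<open>Writing \<open>H_fun\<close> as \<open>z / (1 - S)\<close> times
  \<open>1 / (1 - z)^2 - S / (1 - z)\<close> reduces the expansion to the geometric series and its
  derivative.\<close>

lemma taylor_coeff_H_fun:
  assumes "S_fun \<sigma> t \<noteq> 1" "n > 0"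
  shows "taylor_coeff (H_fun \<sigma> t) n = (of_nat n - S_fun \<sigma> t) / (1 - S_fun \<sigma> t)"
proof -
  define S where "S = S_fun \<sigma> t"
  have S: "1 - S \<noteq> 0"
    using assms by (simp add: S_def)
  define F where "F = Abs_fps (\<lambda>n. if n = 0 then 0 else (of_nat n - S) / (1 - S))"
  have "(\<lambda>n. fps_nth F n * z ^ n) sums H_fun \<sigma> t z" if "z \<in> unit_disk" for z
  proof -
    have z: "norm z < 1" "1 - z \<noteq> 0"
      using that by auto
    have "(\<lambda>n. z / (1 - S) * (of_nat (Suc n) * z ^ n - S * z ^ n)) sums
        (z / (1 - S) * (1 / (1 - z)\<^sup>2 - S * (1 / (1 - z))))"
      by (intro sums_mult sums_diff geometric_sums geometric_deriv_sums z)
    also have "z / (1 - S) * (1 / (1 - z)\<^sup>2 - S * (1 / (1 - z))) = H_fun \<sigma> t z"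
      by (simp add: H_fun_def diff_divide_distrib algebra_simps power2_eq_square flip: S_def)
    also have "(\<lambda>n. z / (1 - S) * (of_nat (Suc n) * z ^ n - S * z ^ n)) =
        (\<lambda>n. fps_nth F (Suc n) * z ^ Suc n)"
      using S by (simp add: F_def fun_eq_iff field_simps)
    finally show ?thesis
      \<comment> \<open>The index shift caused by the factor \<open>z\<close> adds no term, since
        the coefficient of \<open>F\<close> at 0 is 0.\<close>
      by (subst (asm) sums_Suc_iff) (simp add: F_def)
  qed
  then have "\<forall>\<^sub>F z in nhds 0. (\<lambda>n. fps_nth F n * z ^ n) sums H_fun \<sigma> t z"
    by (intro eventually_nhds_in_open[THEN eventually_mono, of unit_disk]) auto
  then have "H_fun \<sigma> t has_fps_expansion F"
    by (rule has_fps_expansionI)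
  then have "fps_expansion (H_fun \<sigma> t) 0 = F"
    by (rule fps_expansion_eqI)
  then show ?thesis
    using assms by (simp add: taylor_coeff_def F_def S_def)
qed

text \<open>Multiplying the coefficients of \<open>f\<close> by \<open>n\<close> produces
  \<open>z f'\<close>, and multiplying them by \<open>S\<close> produces \<open>S f\<close>.\<close>

lemma hadamard_H_fun:
  assumes f: "f \<in> class_A" and S: "S_fun \<sigma> t \<noteq> 1" and z: "z \<in> unit_disk"
  shows "hadamard f (H_fun \<sigma> t) z = (z * deriv f z - S_fun \<sigma> t * f z) / (1 - S_fun \<sigma> t)"
proof -
  define S where "S = S_fun \<sigma> t"
  define c where "c = taylor_coeff f"
  have hol: "f holomorphic_on unit_disk"
    using f by (simp add: class_A_def)
  have c_eq: "c n = (deriv ^^ n) f 0 / fact n" for n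
    by (simp add: c_def taylor_coeff_def fps_expansion_def)
  have c01: "c 0 = 0" "c 1 = 1"
    using class_A_at_0[OF f] by (simp_all add: c_eq)
  have sf: "(\<lambda>n. c n * z ^ n) sums f z"
    using holomorphic_power_series[OF hol z] by (simp add: c_eq)
  have "deriv f holomorphic_on unit_disk"
    by (intro holomorphic_deriv hol) auto
  from holomorphic_power_series[OF this z]
  have "(\<lambda>n. (deriv ^^ Suc n) f 0 / fact n * z ^ n) sums deriv f z"
    by (simp add: funpow_Suc_right del: funpow.simps)
  from sums_mult[OF this, of z]
  have "(\<lambda>n. of_nat (Suc n) * c (Suc n) * z ^ Suc n) sums (z * deriv f z)"
    by (simp add: c_eq field_simps del: of_nat_Suc funpow.simps)
  then have sd: "(\<lambda>n. of_nat n * c n * z ^ n) sums (z * deriv f z)"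
    by (subst (asm) sums_Suc_iff) simp
  define g where "g = (\<lambda>n. c n * ((of_nat n - S) / (1 - S)) * z ^ n)"
  have "(\<lambda>n. (of_nat n * c n * z ^ n - S * (c n * z ^ n)) / (1 - S)) sums
      ((z * deriv f z - S * f z) / (1 - S))"
    by (intro sums_divide sums_diff sums_mult sf sd)
  then have "g sums ((z * deriv f z - S * f z) / (1 - S))"
    by (simp add: g_def algebra_simps diff_divide_distrib)
  then have "(\<lambda>n. g (n + 2)) sums ((z * deriv f z - S * f z) / (1 - S) - (\<Sum>i<2. g i))"
    by (subst sums_iff_shift) simp
  \<comment> \<open>\<open>hadamard\<close> prescribes the terms of index 0 and 1; they agree with
    those of \<open>g\<close>, as \<open>c 0 = 0\<close>, \<open>c 1 = 1\<close> and the factor at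
    index 1 is \<open>(1 - S) / (1 - S)\<close>.\<close>
  moreover have "(\<Sum>i<2. g i) = z"
    using S c01 by (simp add: g_def eval_nat_numeral flip: S_def)
  ultimately have "(\<Sum>n. g (n + 2)) = (z * deriv f z - S * f z) / (1 - S) - z"
    by (simp add: sums_iff)
  moreover have "hadamard f (H_fun \<sigma> t) z = z + (\<Sum>n. g (n + 2))"
    unfolding hadamard_def g_def by (simp add: taylor_coeff_H_fun[OF S] c_def S_def)
  ultimately show ?thesis
    by (simp add: S_def)
qed

text \<open>Since \<open>1 / 0 = 0\<close>, the bare quotient would vanish at 0. Its limit is
  \<open>(1 - S) / (1 - S)\<close>, because \<open>f w / w\<close> and \<open>deriv f w\<close> both
  tend to 1.\<close>

lemma remove_sings_hadamard_H_fun_at_0: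
  assumes f: "f \<in> class_A" and S: "S_fun \<sigma> t \<noteq> 1"
  shows "remove_sings (\<lambda>w. 1 / w * hadamard f (H_fun \<sigma> t) w) 0 = 1"
proof (rule remove_sings_eqI)
  define S where "S = S_fun \<sigma> t"
  have hol: "f holomorphic_on unit_disk"
    using f by (simp add: class_A_def)
  have "(f has_field_derivative deriv f 0) (at 0)"
    by (rule holomorphic_derivI[OF hol]) auto
  then have 1: "((\<lambda>w. f w / w) \<longlongrightarrow> 1) (at 0)"
    using class_A_at_0[OF f] by (simp add: has_field_derivative_iff)
  have "isCont (deriv f) 0"
    by (rule continuous_on_interior[of unit_disk])
       (auto intro!: holomorphic_on_imp_continuous_on holomorphic_deriv hol)
  then have 2: "(deriv f \<longlongrightarrow> 1) (at 0)"
    using class_A_at_0[OF f] by (simp add: isCont_def)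
  have "((\<lambda>w. (deriv f w - S * (f w / w)) / (1 - S)) \<longlongrightarrow> (1 - S * 1) / (1 - S)) (at 0)"
    using S by (intro tendsto_intros 1 2) (simp add: S_def)
  then have lim: "((\<lambda>w. (deriv f w - S * (f w / w)) / (1 - S)) \<longlongrightarrow> 1) (at 0)"
    using S by (simp add: S_def)
  have "\<forall>\<^sub>F w in at 0. w \<in> unit_disk - {0}"
    by (rule eventually_at_in_open) auto
  then have "\<forall>\<^sub>F w in at 0. 1 / w * hadamard f (H_fun \<sigma> t) w =
      (deriv f w - S * (f w / w)) / (1 - S)"
  proof eventually_elim
    case (elim w)
    then have "deriv f w - S * (f w / w) = (w * deriv f w - S * f w) / w"
      by (simp add: field_simps)
    then show ?case
      using elim hadamard_H_fun[OF f S, of w] by (simp add: S_def)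
  qed
  then show "((\<lambda>w. 1 / w * hadamard f (H_fun \<sigma> t) w) \<longlongrightarrow> 1) (at 0)"
    using lim by (subst tendsto_cong)
qed

text \<open>Away from 0 the closed form of the quotient is continuous, so its limit is its
  value.\<close>

lemma remove_sings_hadamard_H_fun:
  assumes f: "f \<in> class_A" and S: "S_fun \<sigma> t \<noteq> 1" and z: "z \<in> unit_disk" "z \<noteq> 0"
  shows "remove_sings (\<lambda>w. 1 / w * hadamard f (H_fun \<sigma> t) w) z =
    (z * deriv f z - S_fun \<sigma> t * f z) / (z * (1 - S_fun \<sigma> t))"
proof (rule remove_sings_eqI)
  define S where "S = S_fun \<sigma> t"
  have hol: "f holomorphic_on unit_disk"
    using f by (simp add: class_A_def)
  have "isCont f z" "isCont (deriv f) z"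
    using z by (auto intro!: continuous_on_interior[of unit_disk] holomorphic_on_imp_continuous_on
        holomorphic_deriv hol)
  then have lim: "((\<lambda>w. (w * deriv f w - S * f w) / (w * (1 - S))) \<longlongrightarrow>
      (z * deriv f z - S * f z) / (z * (1 - S))) (at z)"
    using S z by (intro tendsto_intros) (auto simp: isCont_def S_def)
  have "\<forall>\<^sub>F w in at z. w \<in> unit_disk - {z}"
    using z by (intro eventually_at_in_open) auto
  then have "\<forall>\<^sub>F w in at z. 1 / w * hadamard f (H_fun \<sigma> t) w =
      (w * deriv f w - S * f w) / (w * (1 - S))"
    by eventually_elim (use hadamard_H_fun[OF f S] in \<open>simp add: S_def\<close>)
  then show "((\<lambda>w. 1 / w * hadamard f (H_fun \<sigma> t) w) \<longlongrightarrow>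
      (z * deriv f z - S_fun \<sigma> t * f z) / (z * (1 - S_fun \<sigma> t))) (at z)"
    using lim by (subst tendsto_cong) (auto simp: S_def)
qed

theorem theorem3p1:
  fixes f :: "complex \<Rightarrow> complex"
  assumes "f \<in> class_S"
  shows "f \<in> class_SL \<longleftrightarrow>
    (\<forall>t::real. 0 < t \<and> t < 2 \<longrightarrow>
      (\<forall>\<sigma>\<in>{1, -1}. \<forall>z\<in>unit_disk.
        remove_sings (\<lambda>w. 1 / w * hadamard f (H_fun \<sigma> t) w) z \<noteq> 0))"
proof -
  define p where "p = (\<lambda>z. if z = 0 then 1 else z * deriv f z / f z)"
  have f: "f \<in> class_A" and inj: "inj_on f unit_disk"
    using assms by (auto simp: class_S_def)
  have hol: "f holomorphic_on unit_disk"
    using f by (simp add: class_A_def)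
  note f0 = class_A_at_0[OF f]
  have fnz: "f z \<noteq> 0" if "z \<in> unit_disk" "z \<noteq> 0" for z
    using inj_onD[OF inj, of z 0] that f0 by auto
  \<comment> \<open>Univalence makes the derivative zero-free, which is how \<open>p\<close> avoids
    the node \<open>0\<close>.\<close>
  have dnz: "deriv f z \<noteq> 0" if "z \<in> unit_disk" for z
    using holomorphic_injective_imp_regular[OF hol _ inj] that by auto
  \<comment> \<open>\<open>g\<close> is \<open>f z / z\<close> with its singularity removed; writing
    \<open>p\<close> as \<open>deriv f z / g z\<close> shows holomorphy at 0 too.\<close>
  define g where "g = (\<lambda>z. if z = 0 then deriv f 0 else (f z - f 0) / (z - 0))"
  have "g holomorphic_on unit_disk"
    unfolding g_def by (rule pole_lemma[OF hol]) auto
  moreover have "g z \<noteq> 0" if "z \<in> unit_disk" for z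
    using fnz[OF that] f0 by (auto simp: g_def)
  ultimately have "(\<lambda>z. deriv f z / g z) holomorphic_on unit_disk"
    by (intro holomorphic_on_divide holomorphic_deriv hol) auto
  moreover have "p = (\<lambda>z. deriv f z / g z)"
    using f0 by (simp add: p_def g_def fun_eq_iff)
  ultimately have holp: "p holomorphic_on unit_disk"
    by presburger
  have p0: "p 0 = 1"
    by (simp add: p_def)
  have pnz: "p z \<noteq> 0" if "z \<in> unit_disk" for z
    using fnz[OF that] dnz[OF that] by (auto simp: p_def)
  have SL: "f \<in> class_SL \<longleftrightarrow> p ` unit_disk \<subseteq> half_lemniscate"
    using f subordinate_csqrt_iff[OF holp p0] by (simp add: class_SL_def p_def)
  \<comment> \<open>At \<open>z = 0\<close> both sides are true: the left value is 1, and
    \<open>p 0 = 1\<close> differs from \<open>S_fun \<sigma> t\<close>. Elsewhere the numerator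
    \<open>z f' - S f\<close> vanishes exactly when \<open>p z = S\<close>, as
    \<open>f z \<noteq> 0\<close>.\<close>
  have eq: "remove_sings (\<lambda>w. 1 / w * hadamard f (H_fun \<sigma> t) w) z \<noteq> 0 \<longleftrightarrow> p z \<noteq> S_fun \<sigma> t"
    if "0 < t" "t < 2" "\<sigma> \<in> {1, -1}" "z \<in> unit_disk" for t \<sigma> z
  proof (cases "z = 0")
    case True
    then show ?thesis
      using remove_sings_hadamard_H_fun_at_0[OF f] S_fun_neq_1[OF that(1-3)] p0 by auto
  next
    case False
    then show ?thesis
      using S_fun_neq_1[OF that(1-3)] fnz[OF that(4)]
      by (subst remove_sings_hadamard_H_fun[OF f _ that(4)]) (auto simp: p_def field_simps)
  qed
  have "p ` unit_disk \<subseteq> half_lemniscate \<longleftrightarrow>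
      (\<forall>t \<sigma> z. 0 < t \<longrightarrow> t < 2 \<longrightarrow> \<sigma> \<in> {1, -1} \<longrightarrow> z \<in> unit_disk \<longrightarrow> p z \<noteq> S_fun \<sigma> t)"
    (is "?L \<longleftrightarrow> ?R")
  proof
    assume ?L
    \<comment> \<open>The inequality is strict inside the half lemniscate, whereas every
      \<open>S_fun \<sigma> t\<close> attains the value 1.\<close>
    then have "norm ((p z)\<^sup>2 - 1) < 1" if "z \<in> unit_disk" for z
      using that by (force simp: half_lemniscate_def image_subset_iff)
    then show ?R
      using norm_S_fun_square_minus_1 by (metis less_irrefl)
  next
    assume ?R
    then show ?L
      using holomorphic_image_subset_half_lemniscate[OF holp p0 pnz] by blast
  qed
  then show ?thesis
    using SL eq by blast
qed

end
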